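(* Let $d$ be a square-free rational integer with $d\not\equiv 1\pmod 4$, let $K=\mathbb{Q}(\sqrt{d})$ with ring of algebraic integers $O_{K}=\mathbb{Z}[\sqrt{d}]$, and let $\sigma,\tau$ be two different non-zero ring endomorphisms of $O_{K}$. Let $D:O_{K}\to O_{K}$ be a $(\sigma,\tau)$-derivation with $D(\sqrt{d})=c_{0}+c_{1}\sqrt{d}$, where $c_{0},c_{1}\in\mathbb{Z}$. Then $D$ is inner if and only if $c_{0}$ is divisible by $2d$ and $c_{1}$ is even. In particular: (i) $D$ is inner if $2d$ divides both $c_{0}$ and $c_{1}$; (ii) $O_{K}$ has non-trivial outer $(\sigma,\tau)$-derivations, that is, $\mathrm{Out}_{(\sigma,\tau)}(O_{K})\neq\{0\}$.
   Context: $O_{K}$ is regarded as a commutative unital $\mathbb{Z}$-algebra. A $(\sigma,\tau)$-derivation of $O_{K}$ is a $\mathbb{Z}$-linear map $D:O_{K}\to O_{K}$ with $D(xy)=D(x)\tau(y)+\sigma(x)D(y)$ for all $x,y\in O_{K}$. It is called inner if there exists $\beta\in O_{K}$ with $D(x)=\beta\tau(x)-\sigma(x)\beta$ for all $x\in O_{K}$. $\mathrm{Out}_{(\sigma,\tau)}(O_{K})$ denotes the quotient of the $\mathbb{Z}$-module $\mathcal{D}_{(\sigma,\tau)}(O_{K})$ of all $(\sigma,\tau)$-derivations by the submodule $\mathrm{Inn}_{(\sigma,\tau)}(O_{K})$ of inner ones. *)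

theory Defs
  imports
    "HOL-Algebra.Algebra"
    "HOL-Algebra.Algebraic_Closure_Type"
    "HOL-Computational_Algebra.Computational_Algebra"
    "HOL-Number_Theory.Cong"
    "HOL-Analysis.Complex_Transcendental"
begin

section \<open>Twisted derivations of an algebra\<close>

text \<open>
  All maps between carriers are taken extensional, so that equality of HOL functions is equality
  of maps on the carrier. Endomorphisms are only required to be additive and
  multiplicative (unlike members of \<^const>\<open>ring_hom\<close>, they need not preserve the unit), so the zero
  map is one of them.
\<close>

definition ring_endomorphisms :: "('a, 'm) ring_scheme \<Rightarrow> ('a \<Rightarrow> 'a) set" where
  "ring_endomorphisms A = {f \<in> carrier A \<rightarrow>\<^sub>E carrier A.
     (\<forall>x\<in>carrier A. \<forall>y\<in>carrier A. f (x \<oplus>\<^bsub>A\<^esub> y) = f x \<oplus>\<^bsub>A\<^esub> f y) \<and>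
     (\<forall>x\<in>carrier A. \<forall>y\<in>carrier A. f (x \<otimes>\<^bsub>A\<^esub> y) = f x \<otimes>\<^bsub>A\<^esub> f y)}"

definition zero_map :: "('a, 'm) ring_scheme \<Rightarrow> 'a \<Rightarrow> 'a" where
  "zero_map A = (\<lambda>x\<in>carrier A. \<zero>\<^bsub>A\<^esub>)"

definition twisted_derivations ::
    "('r, 'n) ring_scheme \<Rightarrow> ('r, 'a, 'm) module_scheme \<Rightarrow> ('a \<Rightarrow> 'a) \<Rightarrow> ('a \<Rightarrow> 'a) \<Rightarrow> ('a \<Rightarrow> 'a) set" where
  "twisted_derivations R A \<sigma> \<tau> = {D \<in> carrier A \<rightarrow>\<^sub>E carrier A.
     (\<forall>x\<in>carrier A. \<forall>y\<in>carrier A. D (x \<oplus>\<^bsub>A\<^esub> y) = D x \<oplus>\<^bsub>A\<^esub> D y) \<and>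
     (\<forall>r\<in>carrier R. \<forall>x\<in>carrier A. D (r \<odot>\<^bsub>A\<^esub> x) = r \<odot>\<^bsub>A\<^esub> D x) \<and>
     (\<forall>x\<in>carrier A. \<forall>y\<in>carrier A. D (x \<otimes>\<^bsub>A\<^esub> y) = D x \<otimes>\<^bsub>A\<^esub> \<tau> y \<oplus>\<^bsub>A\<^esub> \<sigma> x \<otimes>\<^bsub>A\<^esub> D y)}"

definition inner_twisted_derivations ::
    "('r, 'n) ring_scheme \<Rightarrow> ('r, 'a, 'm) module_scheme \<Rightarrow> ('a \<Rightarrow> 'a) \<Rightarrow> ('a \<Rightarrow> 'a) \<Rightarrow> ('a \<Rightarrow> 'a) set" where
  "inner_twisted_derivations R A \<sigma> \<tau> = {D \<in> twisted_derivations R A \<sigma> \<tau>.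
     \<exists>\<beta>\<in>carrier A. \<forall>x\<in>carrier A. D x = \<beta> \<otimes>\<^bsub>A\<^esub> \<tau> x \<ominus>\<^bsub>A\<^esub> \<sigma> x \<otimes>\<^bsub>A\<^esub> \<beta>}"

text \<open>
  The fields \<^const>\<open>monoid.mult\<close> and \<^const>\<open>monoid.one\<close> of a \<^type>\<open>module\<close> record have no meaning for a
  module that is not an algebra; they are left \<^const>\<open>undefined\<close>.
\<close>

definition derivation_module ::
    "('r, 'n) ring_scheme \<Rightarrow> ('r, 'a, 'm) module_scheme \<Rightarrow> ('a \<Rightarrow> 'a) \<Rightarrow> ('a \<Rightarrow> 'a) \<Rightarrow> ('r, 'a \<Rightarrow> 'a) module" where
  "derivation_module R A \<sigma> \<tau> =
     \<lparr>carrier = twisted_derivations R A \<sigma> \<tau>, monoid.mult = undefined, monoid.one = undefined,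
      ring.zero = zero_map A, add = (\<lambda>D E. \<lambda>x\<in>carrier A. D x \<oplus>\<^bsub>A\<^esub> E x),
      module.smult = (\<lambda>r D. \<lambda>x\<in>carrier A. r \<odot>\<^bsub>A\<^esub> D x)\<rparr>"

text \<open>
  Translating by \<open>N\<close> in the scalar multiplication turns the set of multiples of the elements of a coset
  into a full coset, \<open>r (N + x) = N + r x\<close>.
\<close>

definition quotient_module :: "('r, 'a, 'm) module_scheme \<Rightarrow> 'a set \<Rightarrow> ('r, 'a set) module" where
  "quotient_module M N =
     \<lparr>carrier = a_rcosets\<^bsub>M\<^esub> N, monoid.mult = undefined, monoid.one = undefined,
      ring.zero = N, add = set_add M, module.smult = (\<lambda>r S. set_add M N ((\<lambda>x. r \<odot>\<^bsub>M\<^esub> x) ` S))\<rparr>"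

definition Out ::
    "('r, 'n) ring_scheme \<Rightarrow> ('r, 'a, 'm) module_scheme \<Rightarrow> ('a \<Rightarrow> 'a) \<Rightarrow> ('a \<Rightarrow> 'a) \<Rightarrow> ('r, ('a \<Rightarrow> 'a) set) module" where
  "Out R A \<sigma> \<tau> = quotient_module (derivation_module R A \<sigma> \<tau>) (inner_twisted_derivations R A \<sigma> \<tau>)"

section \<open>Quadratic fields and their rings of integers\<close>

definition sqrt_int :: "int \<Rightarrow> complex" where
  "sqrt_int d = csqrt (of_int d)"

text \<open>The smallest subfield of the complex numbers that contains \<^term>\<open>sqrt_int d\<close>; it contains the
  rational numbers automatically.\<close>

definition quadratic_field :: "int \<Rightarrow> complex set" where
  "quadratic_field d = generate_field ring_of_type_algebra {sqrt_int d}"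

definition ring_of_integers :: "int \<Rightarrow> (int, complex) module" where
  "ring_of_integers d =
     \<lparr>carrier = {x \<in> quadratic_field d. algebraic_int x}, monoid.mult = (*), monoid.one = 1,
      ring.zero = 0, add = (+), module.smult = (\<lambda>n x. of_int n * x)\<rparr>"

end

theory Submission
  imports Defs
begin

text \<open>The ring of integers is \<open>\<int> + \<int>\<surd>d\<close>, whose only non-zero endomorphisms are the identity and the
  conjugation, so \<open>\<tau> - \<sigma>\<close> maps \<open>a + b\<surd>d\<close> to \<open>\<plusminus>2b\<surd>d\<close>. A derivation kills \<open>\<int>\<close> and is thus determined by
  its value at \<open>\<surd>d\<close>; for the inner derivation of \<open>\<beta> = u + v\<surd>d\<close> this value is \<open>\<plusminus>(2dv + 2u\<surd>d)\<close>. The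
  derivation with value \<open>1\<close> at \<open>\<surd>d\<close> is therefore not inner.\<close>

section \<open>Square divisors and square-free integers\<close>

text \<open>Dividing out the gcd leaves \<open>c'\<close> coprime to \<open>b'\<close>, so
  \<open>c'\<^sup>2\<close> has to divide \<open>d\<close> itself, and square-freeness makes
  \<open>c'\<close> a unit.\<close>

lemma squarefree_square_dvd:
  fixes d b c :: int
  assumes "squarefree d" and "c\<^sup>2 dvd d * b\<^sup>2" and "c \<noteq> 0"
  shows "c dvd b"
proof -
  define g where "g = gcd c b"
  have "g \<noteq> 0" using \<open>c \<noteq> 0\<close> by (simp add: g_def)
  obtain c' b' where c: "c = c' * g" and b: "b = b' * g" and cop: "coprime c' b'"
    using gcd_coprime_exists[of c b] \<open>g \<noteq> 0\<close> unfolding g_def by auto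
  have "c'\<^sup>2 * g\<^sup>2 dvd (d * b'\<^sup>2) * g\<^sup>2"
    using assms(2) by (simp add: c b power_mult_distrib mult.assoc)
  hence "c'\<^sup>2 dvd d * b'\<^sup>2" using \<open>g \<noteq> 0\<close> by simp
  moreover have "coprime (c'\<^sup>2) (b'\<^sup>2)" using cop by simp
  ultimately have "c'\<^sup>2 dvd d" by (simp add: coprime_dvd_mult_left_iff)
  hence "c' dvd 1" using assms(1) by (rule squarefreeD[rotated])
  hence "c' dvd b'" by (rule dvd_trans) simp
  thus ?thesis by (simp add: c b)
qed

section \<open>Integral polynomials and Gauss's lemma\<close>

abbreviation ipoly :: "int poly \<Rightarrow> 'a \<Rightarrow> 'a :: field_char_0" where
  "ipoly p x \<equiv> poly (map_poly of_int p) x"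

lemma ipoly_add: "ipoly (p + q) x = ipoly p x + ipoly q x"
proof -
  have "map_poly of_int (p + q) = map_poly of_int p + (map_poly of_int q :: 'a poly)"
    by (rule poly_eqI) (simp add: coeff_map_poly)
  thus ?thesis by simp
qed

lemma ipoly_pCons: "ipoly (pCons a p) x = of_int a + x * ipoly p x"
  by (simp add: map_poly_pCons)

lemma ipoly_smult: "ipoly (smult c p) x = of_int c * ipoly p x"
  by (simp add: map_poly_smult)

lemma ipoly_mult: "ipoly (p * q) x = ipoly p x * ipoly q x"
  by (induction p) (simp_all add: ipoly_add ipoly_pCons ipoly_smult algebra_simps)

text \<open>\<open>h\<close> is an integral multiple of the minimal polynomial of \<open>x\<close>; by Gauss's lemma its primitive
  part divides a monic integral polynomial, so it is itself monic up to sign.\<close>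

lemma coeff_dvd_of_algebraic_int:
  fixes h :: "int poly" and x :: "'a :: field_char_0"
  assumes alg: "algebraic_int x" and root: "ipoly h x = 0" and "h \<noteq> 0"
    and minimal: "\<And>r :: int poly. degree r < degree h \<Longrightarrow> ipoly r x = 0 \<Longrightarrow> r = 0"
  shows "lead_coeff h dvd coeff h i"
proof -
  obtain f where f: "ipoly f x = 0" "lead_coeff f = 1"
    using alg unfolding algebraic_int_altdef_ipoly by blast
  define g where "g = primitive_part h"
  have h: "h = smult (content h) g" by (simp add: g_def)
  have "content h \<noteq> 0" using \<open>h \<noteq> 0\<close> by simp
  hence deg: "degree g = degree h" and "g \<noteq> 0" and "content g = 1"
    using \<open>h \<noteq> 0\<close> by (auto simp: g_def)
  have groot: "ipoly g x = 0"
    using root \<open>content h \<noteq> 0\<close> by (subst (asm) h) (simp add: ipoly_smult)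
  \<comment> \<open>Multiplying \<open>f\<close> by the power \<open>l\<close> of the leading
    coefficient of \<open>g\<close> keeps division with remainder inside the integral polynomials;
    the remainder vanishes at \<open>x\<close>, so minimality kills it.\<close>
  obtain q r where qr: "pseudo_divmod f g = (q, r)" by fastforce
  define l where "l = lead_coeff g ^ (Suc (degree f) - degree g)"
  have eq: "smult l f = g * q + r" and r: "r = 0 \<or> degree r < degree g"
    using pseudo_divmod[OF \<open>g \<noteq> 0\<close> qr] by (auto simp: l_def)
  have "l \<noteq> 0" using \<open>g \<noteq> 0\<close> by (simp add: l_def)
  have "ipoly r x = 0"
    using arg_cong[OF eq, of "\<lambda>p. ipoly p x"] f(1) groot
    by (simp add: ipoly_add ipoly_mult ipoly_smult)
  hence "r = 0" using r minimal[of r] deg by auto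
  hence eq: "smult l f = g * q" using eq by simp
  have "content f = 1"
  proof -
    have "content f dvd 1" using content_dvd_coeff[of f "degree f"] f(2) by simp
    thus ?thesis by (metis is_unit_normalize normalize_content)
  qed
  \<comment> \<open>Contents are multiplicative, so \<open>l\<close> divides every coefficient of
    \<open>q\<close>. As \<open>f\<close> is monic, \<open>l\<close> is also the product of the
    leading coefficients of \<open>g\<close> and \<open>q\<close>; cancelling leaves a unit as
    leading coefficient of \<open>g\<close>.\<close>
  hence "content q = normalize l"
    using arg_cong[OF eq, of content] \<open>content g = 1\<close> by (simp add: content_mult)
  hence "l dvd content q" by simp
  also have "content q dvd lead_coeff q" by (rule content_dvd_coeff)
  finally obtain k where k: "lead_coeff q = l * k" by blast
  have "l = lead_coeff g * lead_coeff q"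
    using arg_cong[OF eq, of lead_coeff] f(2) \<open>l \<noteq> 0\<close> by (simp add: lead_coeff_mult)
  hence "lead_coeff g dvd 1" using k \<open>l \<noteq> 0\<close> by (metis dvd_triv_left mult.left_commute mult_cancel_left2)
  hence "content h * lead_coeff g dvd content h * coeff g i"
    by (meson dvd_trans mult_dvd_mono dvd_refl one_dvd)
  thus ?thesis using h by (metis coeff_smult lead_coeff_smult)
qed

section \<open>Squares modulo 4\<close>

text \<open>Square-freeness rules out residue 0 and the congruence hypothesis residue 1, so
  \<open>d\<close> is 2 or 3 modulo 4. Squares are 0 or 1 modulo 4, and trying all cases leaves only
  two even numbers. This is what excludes denominators 2 in the ring of integers.\<close>

lemma square_minus_mult_square_cong_0:
  fixes d m k :: int
  assumes "squarefree d" and "\<not> [d = 1] (mod 4)" and "4 dvd m\<^sup>2 - d * k\<^sup>2"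
  shows "even m \<and> even k"
proof -
  have "\<not> 4 dvd d"
    using squarefreeD[OF assms(1), of 2] by auto
  hence d: "d mod 4 = 2 \<or> d mod 4 = 3"
    using assms(2) unfolding cong_def by presburger
  have sq: "j\<^sup>2 mod 4 = (if even j then 0 else 1)" for j :: int
  proof (cases "even j")
    case False
    then obtain i where "j = 2 * i + 1" by (auto elim: oddE)
    hence "j\<^sup>2 = 4 * (i\<^sup>2 + i) + 1" by (simp add: power2_eq_square algebra_simps)
    thus ?thesis using False by presburger
  qed (auto elim!: evenE)
  have "(m\<^sup>2 mod 4 - (d mod 4) * (k\<^sup>2 mod 4)) mod 4 = (m\<^sup>2 - d * k\<^sup>2) mod 4"
    by (intro mod_diff_cong) (simp_all add: mod_mult_eq)
  hence "(m\<^sup>2 mod 4 - (d mod 4) * (k\<^sup>2 mod 4)) mod 4 = 0"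
    using assms(3) by simp
  thus ?thesis using d by (auto simp: sq split: if_splits)
qed

section \<open>The quadratic field and its algebraic integers\<close>

locale quadratic_order =
  fixes d :: int
  assumes squarefree: "squarefree d" and not_cong_1: "\<not> [d = 1] (mod 4)"
begin

abbreviation s :: complex where "s \<equiv> sqrt_int d"
abbreviation OK :: "(int, complex) module" where "OK \<equiv> ring_of_integers d"

lemma d_nonzero: "d \<noteq> 0"
  using squarefree by auto

lemma s_square: "s * s = of_int d"
  unfolding sqrt_int_def by (metis power2_csqrt power2_eq_square)

text \<open>A non-trivial solution would make \<open>d\<close> a perfect square; the only
  square-free one is 1, which the congruence hypothesis forbids.\<close>

lemma norm_nonzero:
  fixes a b :: int
  assumes "a\<^sup>2 = d * b\<^sup>2"
  shows "a = 0 \<and> b = 0"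
proof (rule ccontr)
  assume "\<not> ?thesis"
  hence "b \<noteq> 0" using assms by auto
  have "b\<^sup>2 dvd a\<^sup>2" using assms by simp
  then obtain e where a: "a = b * e" by (auto simp: pow_divides_pow_iff elim!: dvdE)
  hence d: "d = e\<^sup>2" using assms \<open>b \<noteq> 0\<close> by (simp add: power_mult_distrib)
  hence "is_unit e" using squarefreeD[OF squarefree, of e] by simp
  hence "d = 1" using d by (auto simp: zdvd1_eq abs_if split: if_splits)
  thus False using not_cong_1 by simp
qed

lemma int_lin_s_eq_0:
  fixes a b :: int
  assumes "of_int a + of_int b * s = 0"
  shows "a = 0 \<and> b = 0"
proof (rule norm_nonzero)
  have "of_int (a\<^sup>2) = (of_int b * s) * (of_int b * s)"
    using assms by (simp add: power2_eq_square add_eq_0_iff)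
  also have "\<dots> = of_int (d * b\<^sup>2)"
    by (simp add: s_square[symmetric] power2_eq_square)
  finally show "a\<^sup>2 = d * b\<^sup>2" by (simp only: of_int_eq_iff)
qed

lemma int_lin_s_eq_iff:
  fixes a b a' b' :: int
  shows "of_int a + of_int b * s = of_int a' + of_int b' * s \<longleftrightarrow> a = a' \<and> b = b'"
  using int_lin_s_eq_0[of "a - a'" "b - b'"] by (auto simp: algebra_simps)

text \<open>The fractions of this shape contain the generator and are closed under all field
  operations, so induction over the generated field applies.\<close>

lemma quadratic_field_cases:
  assumes "x \<in> quadratic_field d"
  obtains a b c :: int where "c \<noteq> 0" "x = (of_int a + of_int b * s) / of_int c"
proof -
  interpret K: field "ring_of_type_algebra :: complex ring" by (rule field_from_type_algebra)
  \<comment> \<open>Negatives and inverses of the record are defined through its structure;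
    uniqueness identifies them with the usual complex ones.\<close>
  have minus: "\<ominus>\<^bsub>ring_of_type_algebra\<^esub> y = - y" for y :: complex
    by (rule K.minus_equality) (auto simp: ring_of_type_algebra_def)
  have inv: "inv\<^bsub>ring_of_type_algebra\<^esub> y = inverse y" if "y \<noteq> 0" for y :: complex
    by (rule K.comm_inv_char) (use that in \<open>auto simp: ring_of_type_algebra_def\<close>)
  have "\<exists>a b c :: int. c \<noteq> 0 \<and> x = (of_int a + of_int b * s) / of_int c"
    using assms unfolding quadratic_field_def
  proof (induction rule: generate_field.induct)
    case one
    show ?case
      by (rule exI[of _ 1], rule exI[of _ 0], rule exI[of _ 1]) (simp add: ring_of_type_algebra_def)
  next
    case (incl h)
    thus ?case
      by (intro exI[of _ 0] exI[of _ 1]) (simp add: ring_of_type_algebra_def)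
  next
    case (a_inv h)
    then obtain a b c :: int where h: "c \<noteq> 0" "h = (of_int a + of_int b * s) / of_int c" by blast
    show ?case
      using h(1) by (intro exI[of _ "-a"] exI[of _ "-b"] exI[of _ c])
        (simp add: minus h(2) field_simps)
  next
    case (m_inv h)
    then obtain a b c :: int where h: "c \<noteq> 0" "h = (of_int a + of_int b * s) / of_int c" by blast
    have "h \<noteq> 0" using m_inv by (simp add: ring_of_type_algebra_def)
    hence ab: "of_int a + of_int b * s \<noteq> 0" using h by auto
    hence n: "a\<^sup>2 - d * b\<^sup>2 \<noteq> 0" using norm_nonzero[of a b] by auto
    \<comment> \<open>Rationalising with the conjugate: the denominator becomes the norm, which is
      non-zero.\<close>
    have "(of_int a + of_int b * s) * (of_int a - of_int b * s) = of_int (a\<^sup>2 - d * b\<^sup>2)"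
      by (simp add: s_square[symmetric] power2_eq_square algebra_simps)
    moreover have "of_int (a\<^sup>2 - d * b\<^sup>2) \<noteq> (0 :: complex)"
      using n by (simp only: of_int_eq_0_iff not_False_eq_True)
    ultimately have "inverse h = of_int c * (of_int a - of_int b * s) / of_int (a\<^sup>2 - d * b\<^sup>2)"
      using h ab
      by (simp add: frac_eq_eq inverse_eq_divide mult_ac del: of_int_diff of_int_mult of_int_power)
    thus ?case
      using n by (intro exI[of _ "c * a"] exI[of _ "- (c * b)"] exI[of _ "a\<^sup>2 - d * b\<^sup>2"])
        (simp add: inv[OF \<open>h \<noteq> 0\<close>] algebra_simps)
  next
    case (eng_add h h')
    then obtain a b c a' b' c' :: int
      where h: "c \<noteq> 0" "h = (of_int a + of_int b * s) / of_int c"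
        and h': "c' \<noteq> 0" "h' = (of_int a' + of_int b' * s) / of_int c'" by blast
    show ?case
      using h(1) h'(1)
      by (intro exI[of _ "a * c' + a' * c"] exI[of _ "b * c' + b' * c"] exI[of _ "c * c'"])
        (simp add: ring_of_type_algebra_def h(2) h'(2) field_simps)
  next
    case (eng_mult h h')
    then obtain a b c a' b' c' :: int
      where h: "c \<noteq> 0" "h = (of_int a + of_int b * s) / of_int c"
        and h': "c' \<noteq> 0" "h' = (of_int a' + of_int b' * s) / of_int c'" by blast
    show ?case
      using h(1) h'(1)
      by (intro exI[of _ "a * a' + d * b * b'"] exI[of _ "a * b' + b * a'"] exI[of _ "c * c'"])
        (simp add: ring_of_type_algebra_def h(2) h'(2) s_square[symmetric] field_simps)
  qed
  thus ?thesis using that by blast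
qed

lemma int_lin_s_in_quadratic_field: "of_int a + of_int b * s \<in> quadratic_field d"
proof -
  define K where "K = quadratic_field d"
  interpret C: field "ring_of_type_algebra :: complex ring" by (rule field_from_type_algebra)
  have minus: "\<ominus>\<^bsub>ring_of_type_algebra\<^esub> y = - y" for y :: complex
    by (rule C.minus_equality) (auto simp: ring_of_type_algebra_def)
  have one: "1 \<in> K" and s: "s \<in> K"
    using generate_field.one[of ring_of_type_algebra "{s}"]
      generate_field.incl[of s "{s}" ring_of_type_algebra]
    by (auto simp: K_def quadratic_field_def ring_of_type_algebra_def)
  have add: "x + y \<in> K" and mult: "x * y \<in> K" if "x \<in> K" "y \<in> K" for x y
    using that generate_field.eng_add[of x ring_of_type_algebra "{s}" y]
      generate_field.eng_mult[of x ring_of_type_algebra "{s}" y]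
    by (auto simp: K_def quadratic_field_def ring_of_type_algebra_def)
  have uminus: "- x \<in> K" if "x \<in> K" for x
    using that generate_field.a_inv[of x ring_of_type_algebra "{s}"]
    by (auto simp: K_def quadratic_field_def minus)
  have zero: "0 \<in> K" using add[OF one uminus[OF one]] by simp
  have nat: "of_nat n \<in> K" for n
    by (induction n) (auto intro: zero one add)
  have "of_int n \<in> K" for n
    by (cases n rule: int_cases2) (auto intro: nat uminus)
  thus ?thesis using s add mult by (auto simp: K_def)
qed

lemma algebraic_int_int_lin_s: "algebraic_int (of_int a + of_int b * s)"
proof
  \<comment> \<open>The monic quadratic with the element and its conjugate as roots: norm as
    constant term, minus the trace as linear coefficient.\<close>
  show "poly [:of_int (a\<^sup>2 - d * b\<^sup>2), of_int (- 2 * a), 1:] (of_int a + of_int b * s) = 0"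
    by (simp add: s_square[symmetric] power2_eq_square algebra_simps)
qed (auto simp: coeff_pCons split: nat.splits)

text \<open>For irrational \<open>x\<close>, Gauss's lemma makes the trace \<open>2a/c\<close> and
  the norm \<open>(a\<^sup>2 - d b\<^sup>2)/c\<^sup>2\<close> integers. Then \<open>m = 2a/c\<close>
  and \<open>k = 2b/c\<close> are integers with \<open>m\<^sup>2 - d k\<^sup>2\<close> divisible by
  4, so both are even.\<close>

lemma algebraic_int_quadratic_field:
  assumes "x \<in> quadratic_field d" "algebraic_int x"
  obtains a b :: int where "x = of_int a + of_int b * s"
proof -
  obtain a b c :: int where "c \<noteq> 0" and x: "x = (of_int a + of_int b * s) / of_int c"
    using quadratic_field_cases[OF assms(1)] .
  show ?thesis
  proof (cases "b = 0")
    case True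
    hence "x \<in> \<rat>" by (simp add: x)
    then obtain n :: int where "x = of_int n"
      using rational_algebraic_int_is_int[OF assms(2)] by (auto elim: Ints_cases)
    thus ?thesis using that[of n 0] by simp
  next
    case False
    have cx: "of_int c * x = of_int a + of_int b * s" using \<open>c \<noteq> 0\<close> by (simp add: x)
    \<comment> \<open>This is \<open>(cX - a)\<^sup>2 - d b\<^sup>2\<close>, the minimal polynomial
      of \<open>x\<close> scaled by \<open>c\<^sup>2\<close>.\<close>
    define h where "h = [:a\<^sup>2 - d * b\<^sup>2, - 2 * a * c, c\<^sup>2:]"
    have deg: "degree h = 2" and "h \<noteq> 0" using \<open>c \<noteq> 0\<close> by (auto simp: h_def)
    have "ipoly h x
        = (of_int c * x - of_int a)\<^sup>2 - of_int d * of_int (b\<^sup>2)"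
      by (simp add: h_def ipoly_pCons power2_eq_square algebra_simps)
    also have "\<dots> = 0"
      unfolding cx by (simp add: s_square[symmetric] power2_eq_square algebra_simps)
    finally have root: "ipoly h x = 0" .
    \<comment> \<open>A linear relation for \<open>x\<close> would be one between 1 and
      \<open>s\<close>, which are independent; \<open>b \<noteq> 0\<close> enters here.\<close>
    have minimal: "r = 0" if deg_r: "degree r < degree h" and root_r: "ipoly r x = 0" for r :: "int poly"
    proof -
      obtain r0 r1 where r: "r = [:r0, r1:]"
        using deg_r deg by (cases r rule: pCons_cases) (auto elim!: degree_eq_zeroE split: if_splits)
      have "of_int r0 + of_int r1 * x = 0" using root_r by (simp add: r ipoly_pCons mult.commute)
      hence "of_int c * of_int r0 + of_int r1 * (of_int c * x) = 0"
        by (metis distrib_left mult.left_commute mult_zero_right)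
      hence "of_int (c * r0 + r1 * a) + of_int (r1 * b) * s = 0"
        unfolding cx by (simp add: algebra_simps)
      hence "c * r0 + r1 * a = 0 \<and> r1 * b = 0" by (rule int_lin_s_eq_0)
      thus ?thesis using False \<open>c \<noteq> 0\<close> by (auto simp: r)
    qed
    have dvd: "c\<^sup>2 dvd coeff h i" for i
      using coeff_dvd_of_algebraic_int[OF assms(2) root \<open>h \<noteq> 0\<close> minimal, of i]
      by (simp add: deg) (simp add: h_def numeral_2_eq_2)
    have "c * c dvd (2 * a) * c" using dvd[of 1] by (simp add: h_def power2_eq_square mult.commute)
    hence "c dvd 2 * a" using \<open>c \<noteq> 0\<close> by simp
    then obtain m where m: "2 * a = c * m" by blast
    obtain n where n: "a\<^sup>2 - d * b\<^sup>2 = c\<^sup>2 * n" using dvd[of 0] by (auto simp: h_def)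
    \<comment> \<open>Four times the norm equation shows that \<open>c\<^sup>2\<close> divides
      \<open>d (2b)\<^sup>2\<close>, so square-freeness gives that \<open>c\<close> divides
      \<open>2b\<close>.\<close>
    have "d * (2 * b)\<^sup>2 = (2 * a)\<^sup>2 - 4 * (a\<^sup>2 - d * b\<^sup>2)"
      by (simp add: power2_eq_square algebra_simps)
    also have "\<dots> = c\<^sup>2 * (m\<^sup>2 - 4 * n)"
      unfolding m n by (simp add: power2_eq_square algebra_simps)
    finally have eq: "d * (2 * b)\<^sup>2 = c\<^sup>2 * (m\<^sup>2 - 4 * n)" .
    hence "c dvd 2 * b" using squarefree_square_dvd[OF squarefree _ \<open>c \<noteq> 0\<close>, of "2 * b"] by simp
    then obtain k where k: "2 * b = c * k" by blast
    have "c\<^sup>2 * (d * k\<^sup>2) = c\<^sup>2 * (m\<^sup>2 - 4 * n)"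
      using eq unfolding k by (simp add: power2_eq_square algebra_simps)
    hence "m\<^sup>2 - d * k\<^sup>2 = 4 * n" using \<open>c \<noteq> 0\<close> by simp
    hence "even m \<and> even k"
      using square_minus_mult_square_cong_0[OF squarefree not_cong_1, of m k] by simp
    then obtain m' k' where "m = 2 * m'" "k = 2 * k'" by (auto elim!: evenE)
    hence "a = c * m'" "b = c * k'" using m k by auto
    hence "x = of_int m' + of_int k' * s" using \<open>c \<noteq> 0\<close> by (simp add: x field_simps)
    thus ?thesis by (rule that)
  qed
qed

lemma carrier_OK: "carrier OK = {of_int a + of_int b * s | a b :: int. True}"
  using algebraic_int_quadratic_field int_lin_s_in_quadratic_field algebraic_int_int_lin_s
  unfolding ring_of_integers_def by auto metis

section \<open>Arithmetic in the ring \<open>OK\<close>\<close>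

lemma OK_simps [simp]:
  "x \<otimes>\<^bsub>OK\<^esub> y = x * y" "x \<oplus>\<^bsub>OK\<^esub> y = x + y" "\<one>\<^bsub>OK\<^esub> = 1" "\<zero>\<^bsub>OK\<^esub> = 0"
  "n \<odot>\<^bsub>OK\<^esub> x = of_int n * x"
  by (simp_all add: ring_of_integers_def)

lemma OK_I [intro]: "of_int a + of_int b * s \<in> carrier OK"
  by (auto simp: carrier_OK)

lemma OK_E:
  assumes "x \<in> carrier OK"
  obtains a b :: int where "x = of_int a + of_int b * s"
  using assms by (auto simp: carrier_OK)

lemma OK_of_int [simp, intro]: "of_int a \<in> carrier OK"
  using OK_I[of a 0] by simp

lemma OK_s [simp, intro]: "s \<in> carrier OK"
  using OK_I[of 0 1] by simp

lemma OK_0 [simp, intro]: "0 \<in> carrier OK" and OK_1 [simp, intro]: "1 \<in> carrier OK"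
  using OK_of_int[of 0] OK_of_int[of 1] by simp_all

lemma OK_add [intro]:
  assumes "x \<in> carrier OK" "y \<in> carrier OK"
  shows "x + y \<in> carrier OK"
proof -
  obtain a b where x: "x = of_int a + of_int b * s" using assms(1) by (rule OK_E)
  obtain a' b' where y: "y = of_int a' + of_int b' * s" using assms(2) by (rule OK_E)
  show ?thesis using OK_I[of "a + a'" "b + b'"] by (simp add: x y algebra_simps)
qed

lemma OK_mult [intro]:
  assumes "x \<in> carrier OK" "y \<in> carrier OK"
  shows "x * y \<in> carrier OK"
proof -
  obtain a b where x: "x = of_int a + of_int b * s" using assms(1) by (rule OK_E)
  obtain a' b' where y: "y = of_int a' + of_int b' * s" using assms(2) by (rule OK_E)
  show ?thesis using OK_I[of "a * a' + d * b * b'" "a * b' + b * a'"]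
    by (simp add: x y s_square[symmetric] algebra_simps)
qed

lemma OK_minus [intro]:
  assumes "x \<in> carrier OK"
  shows "- x \<in> carrier OK"
  using OK_mult[OF OK_of_int[of "-1"] assms] by simp

lemma OK_a_minus:
  assumes "x \<in> carrier OK" "y \<in> carrier OK"
  shows "x \<ominus>\<^bsub>OK\<^esub> y = x - y"
proof -
  have "abelian_group OK"
    by (rule abelian_groupI)
      (auto simp: add_ac intro!: bexI[of _ "- z" for z] OK_add OK_minus)
  hence "\<ominus>\<^bsub>OK\<^esub> y = - y"
    by (rule abelian_group.minus_equality) (use assms in auto)
  thus ?thesis by (simp add: a_minus_def)
qed

section \<open>Ring endomorphisms of \<open>OK\<close>\<close>

text \<open>The value at 1 is idempotent, hence 0 or 1, and 0 would force the zero map. So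
  \<open>f\<close> fixes the integers, and squaring \<open>f s\<close> gives \<open>d\<close>, which
  leaves only the two signs.\<close>

lemma endomorphism_cases:
  assumes endo: "f \<in> ring_endomorphisms OK" and "f \<noteq> zero_map OK"
  obtains e :: int where "e = 1 \<or> e = -1"
    "\<And>a b. f (of_int a + of_int b * s) = of_int a + of_int (e * b) * s"
proof -
  have ext: "f \<in> extensional (carrier OK)"
    and add: "\<And>x y. x \<in> carrier OK \<Longrightarrow> y \<in> carrier OK \<Longrightarrow> f (x + y) = f x + f y"
    and mult: "\<And>x y. x \<in> carrier OK \<Longrightarrow> y \<in> carrier OK \<Longrightarrow> f (x * y) = f x * f y"
    using endo by (auto simp: ring_endomorphisms_def PiE_def)
  have "f 1 = 1"
  proof (rule ccontr)
    assume "f 1 \<noteq> 1"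
    hence "f 1 = 0" using mult[of 1 1] by simp
    hence "f x = 0" if "x \<in> carrier OK" for x using mult[of 1 x] that by simp
    hence "f = zero_map OK"
      using ext by (auto simp: zero_map_def extensional_def fun_eq_iff)
    thus False using assms(2) by simp
  qed
  have "f 0 = 0" using add[of 0 0] by simp
  have nat: "f (of_nat n) = of_nat n" for n
  proof (induction n)
    case (Suc n)
    have "of_nat n \<in> carrier OK" using OK_of_int[of "int n"] by simp
    thus ?case using add[of 1 "of_nat n"] Suc \<open>f 1 = 1\<close> by simp
  qed (use \<open>f 0 = 0\<close> in simp)
  have int: "f (of_int n) = of_int n" for n
  proof (cases n rule: int_cases2)
    case (nonpos k)
    have "of_nat k \<in> carrier OK" using OK_of_int[of "int k"] by simp
    hence "f (of_nat k) + f (- of_nat k) = 0"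
      using add[of "of_nat k" "- of_nat k"] \<open>f 0 = 0\<close> by auto
    thus ?thesis using nonpos nat[of k] by (simp add: add_eq_0_iff)
  qed (use nat in simp)
  have "f s * f s = s * s"
    using mult[of s s] int[of d] by (simp add: s_square)
  hence "f s = s \<or> f s = - s" by (simp add: square_eq_iff)
  then obtain e :: int where e: "e = 1 \<or> e = -1" "f s = of_int e * s"
    by (metis mult_1 mult_minus1 of_int_1 of_int_minus)
  have "f (of_int a + of_int b * s) = of_int a + of_int (e * b) * s" for a b
    using add[of "of_int a" "of_int b * s"] mult[of "of_int b" s] e(2) OK_mult[of "of_int b" s]
    by (simp add: int mult_ac)
  thus ?thesis using that e(1) by blast
qed

text \<open>Equal signs would make the maps agree on the carrier and so, being extensional,
  everywhere. Hence the signs are opposite.\<close>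

lemma distinct_endomorphisms:
  assumes "\<sigma> \<in> ring_endomorphisms OK" "\<tau> \<in> ring_endomorphisms OK"
    and "\<sigma> \<noteq> zero_map OK" "\<tau> \<noteq> zero_map OK" "\<sigma> \<noteq> \<tau>"
  obtains e :: int where "e = 1 \<or> e = -1"
    "\<And>a b. \<sigma> (of_int a + of_int b * s) = of_int a + of_int (e * b) * s"
    "\<And>a b. \<tau> (of_int a + of_int b * s) = of_int a - of_int (e * b) * s"
proof -
  obtain e where e: "e = 1 \<or> e = -1"
    "\<And>a b. \<sigma> (of_int a + of_int b * s) = of_int a + of_int (e * b) * s"
    using endomorphism_cases[OF assms(1,3)] by metis
  obtain e' where e': "e' = 1 \<or> e' = -1"
    "\<And>a b. \<tau> (of_int a + of_int b * s) = of_int a + of_int (e' * b) * s"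
    using endomorphism_cases[OF assms(2,4)] by metis
  have "e' \<noteq> e"
  proof
    assume "e' = e"
    hence "\<sigma> x = \<tau> x" if "x \<in> carrier OK" for x using OK_E[OF that] e(2) e'(2) by metis
    hence "\<sigma> = \<tau>"
      using assms(1,2) unfolding ring_endomorphisms_def by (blast intro: PiE_ext)
    thus False using assms(5) by simp
  qed
  hence "e' = - e" using e(1) e'(1) by auto
  thus ?thesis using that[OF e] e'(2) by simp
qed

end

section \<open>Twisted derivations and the criterion for being inner\<close>

text \<open>The sign \<open>e\<close> treats both orders at once: on \<open>OK\<close>, \<sigma> is
  the identity for \<open>e = 1\<close> and the conjugation for \<open>e = -1\<close>, and \<tau> is
  the other one.\<close>

locale twisted_quadratic_order = quadratic_order +
  fixes \<sigma> \<tau> :: "complex \<Rightarrow> complex" and e :: int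
  assumes e: "e = 1 \<or> e = -1"
    and \<sigma>: "\<And>a b. \<sigma> (of_int a + of_int b * s) = of_int a + of_int (e * b) * s"
    and \<tau>: "\<And>a b. \<tau> (of_int a + of_int b * s) = of_int a - of_int (e * b) * s"
begin

text \<open>The product rule at \<open>1 * 1\<close> reads \<open>D 1 = D 1 + D 1\<close>, so
  \<open>D\<close> kills 1 and, being linear, all integers.\<close>

lemma derivation_eq:
  assumes "D \<in> twisted_derivations \<Z> OK \<sigma> \<tau>"
  shows "D (of_int a + of_int b * s) = of_int b * D s"
proof -
  have add: "\<And>x y. x \<in> carrier OK \<Longrightarrow> y \<in> carrier OK \<Longrightarrow> D (x + y) = D x + D y"
    and scale: "\<And>n x. x \<in> carrier OK \<Longrightarrow> D (of_int n * x) = of_int n * D x"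
    and mult: "\<And>x y. x \<in> carrier OK \<Longrightarrow> y \<in> carrier OK \<Longrightarrow> D (x * y) = D x * \<tau> y + \<sigma> x * D y"
    using assms by (auto simp: twisted_derivations_def)
  have "D 1 = 0" using mult[of 1 1] \<sigma>[of 1 0] \<tau>[of 1 0] by simp
  hence "D (of_int a) = 0" using scale[of 1 a] by simp
  thus ?thesis using add[of "of_int a" "of_int b * s"] scale[of s b] by auto
qed

lemma inner_iff:
  assumes D: "D \<in> twisted_derivations \<Z> OK \<sigma> \<tau>"
    and Ds: "D s = of_int c\<^sub>0 + of_int c\<^sub>1 * s"
  shows "D \<in> inner_twisted_derivations \<Z> OK \<sigma> \<tau> \<longleftrightarrow> 2 * d dvd c\<^sub>0 \<and> even c\<^sub>1"
proof -
  have \<sigma>_closed: "\<sigma> x \<in> carrier OK" and \<tau>_closed: "\<tau> x \<in> carrier OK" if x: "x \<in> carrier OK" for x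
  proof -
    obtain a b where x: "x = of_int a + of_int b * s" using x by (rule OK_E)
    show "\<sigma> x \<in> carrier OK" "\<tau> x \<in> carrier OK"
      unfolding x \<sigma> \<tau> using OK_I[of a "e * b"] OK_I[of a "- (e * b)"] by simp_all
  qed
  have inner: "D \<in> inner_twisted_derivations \<Z> OK \<sigma> \<tau>
      \<longleftrightarrow> (\<exists>\<beta>\<in>carrier OK. \<forall>x\<in>carrier OK. D x = \<beta> * (\<tau> x - \<sigma> x))"
    using D \<sigma>_closed \<tau>_closed
    by (auto simp: inner_twisted_derivations_def OK_a_minus OK_mult algebra_simps)
  \<comment> \<open>The difference \<tau> - \<sigma> sends \<open>a + b s\<close> to
    \<open>-2 e b s\<close>. Multiplying by \<open>v s\<close> turns \<open>s * s\<close> into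
    \<open>d\<close>, whence the factor \<open>2d\<close> in the integral coordinate and only 2 in
    the other.\<close>
  have inner_value: "(of_int u + of_int v * s) * (\<tau> (of_int a + of_int b * s) - \<sigma> (of_int a + of_int b * s))
      = of_int b * (of_int (- 2 * e * d * v) + of_int (- 2 * e * u) * s)" for u v a b
    unfolding \<sigma> \<tau> by (simp add: s_square[symmetric] algebra_simps)
  show ?thesis
  proof
    assume "D \<in> inner_twisted_derivations \<Z> OK \<sigma> \<tau>"
    then obtain \<beta> where \<beta>: "\<beta> \<in> carrier OK" "D s = \<beta> * (\<tau> s - \<sigma> s)" unfolding inner by blast
    obtain u v where "\<beta> = of_int u + of_int v * s" using \<beta>(1) by (rule OK_E)
    hence "of_int c\<^sub>0 + of_int c\<^sub>1 * s = of_int (- 2 * e * d * v) + of_int (- 2 * e * u) * s"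
      using \<beta>(2) inner_value[of u v 0 1] Ds by simp
    hence "c\<^sub>0 = - 2 * e * d * v \<and> c\<^sub>1 = - 2 * e * u" by (simp only: int_lin_s_eq_iff)
    thus "2 * d dvd c\<^sub>0 \<and> even c\<^sub>1" by simp
  next
    assume "2 * d dvd c\<^sub>0 \<and> even c\<^sub>1"
    then obtain v u where "c\<^sub>0 = 2 * d * v" "c\<^sub>1 = 2 * u" by (auto elim!: dvdE)
    \<comment> \<open>Since \<open>e * e = 1\<close>, the sign \<open>- e\<close> in the coordinates
      of \<beta> cancels the one in \<open>inner_value\<close>.\<close>
    hence c: "c\<^sub>0 = - 2 * e * d * (- e * v)" "c\<^sub>1 = - 2 * e * (- e * u)" using e by auto
    define \<beta> where "\<beta> = of_int (- e * u) + of_int (- e * v) * s"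
    have "D x = \<beta> * (\<tau> x - \<sigma> x)" if x: "x \<in> carrier OK" for x
    proof -
      obtain a b where x: "x = of_int a + of_int b * s" using x by (rule OK_E)
      show ?thesis unfolding x \<beta>_def inner_value derivation_eq[OF D] Ds c ..
    qed
    moreover have "\<beta> \<in> carrier OK" unfolding \<beta>_def by (rule OK_I)
    ultimately show "D \<in> inner_twisted_derivations \<Z> OK \<sigma> \<tau>" unfolding inner by blast
  qed
qed

text \<open>The witness is the inner derivation of \<open>K\<close> given by \<open>\<beta> = 1 / (\<tau> s - \<sigma> s)\<close>; it maps
  \<open>a + b s\<close> to \<open>b\<close>, hence restricts to integers.\<close>

lemma ex_derivation:
  obtains D where "D \<in> twisted_derivations \<Z> OK \<sigma> \<tau>" "D s = 1"
proof -
  \<comment> \<open>The denominator is \<open>\<tau> s - \<sigma> s\<close>.\<close>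
  define D where "D = (\<lambda>x\<in>carrier OK. (\<tau> x - \<sigma> x) / (- 2 * of_int e * s))"
  have "s \<noteq> 0" using s_square d_nonzero by auto
  have "e \<noteq> 0" using e by auto
  have D: "D (of_int a + of_int b * s) = of_int b" for a b
  proof -
    have "D (of_int a + of_int b * s)
        = (of_int a - of_int (e * b) * s - (of_int a + of_int (e * b) * s)) / (- 2 * of_int e * s)"
      unfolding D_def \<sigma> \<tau> restrict_apply'[OF OK_I] ..
    also have "\<dots> = of_int b" using \<open>s \<noteq> 0\<close> \<open>e \<noteq> 0\<close> by (simp add: field_simps)
    finally show ?thesis .
  qed
  have "D \<in> twisted_derivations \<Z> OK \<sigma> \<tau>"
    unfolding twisted_derivations_def
  proof (intro CollectI conjI ballI PiE_I)
    fix x assume x: "x \<in> carrier OK"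
    show "D x \<in> carrier OK" using OK_E[OF x] D by (metis OK_of_int)
    fix r :: int
    obtain a b where x: "x = of_int a + of_int b * s" using OK_E[OF x] .
    show "D (r \<odot>\<^bsub>OK\<^esub> x) = r \<odot>\<^bsub>OK\<^esub> D x"
    proof -
      have rx: "of_int r * x = of_int (r * a) + of_int (r * b) * s" by (simp add: x algebra_simps)
      show ?thesis unfolding OK_simps rx D unfolding x D by simp
    qed
  next
    fix x y assume "x \<in> carrier OK" "y \<in> carrier OK"
    then obtain a b a' b'
      where x: "x = of_int a + of_int b * s" and y: "y = of_int a' + of_int b' * s"
      by (auto elim!: OK_E)
    show "D (x \<oplus>\<^bsub>OK\<^esub> y) = D x \<oplus>\<^bsub>OK\<^esub> D y"
    proof -
      have xy: "x + y = of_int (a + a') + of_int (b + b') * s" by (simp add: x y algebra_simps)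
      show ?thesis unfolding OK_simps xy D unfolding x y D by simp
    qed
    show "D (x \<otimes>\<^bsub>OK\<^esub> y) = D x \<otimes>\<^bsub>OK\<^esub> \<tau> y \<oplus>\<^bsub>OK\<^esub> \<sigma> x \<otimes>\<^bsub>OK\<^esub> D y"
    proof -
      have xy: "x * y = of_int (a * a' + d * b * b') + of_int (a * b' + b * a') * s"
        by (simp add: x y s_square[symmetric] algebra_simps)
      \<comment> \<open>The terms \<open>- e b b' s\<close> from \<tau> and \<open>e b b' s\<close>
        from \<sigma> cancel, leaving \<open>a b' + b a'\<close>.\<close>
      show ?thesis unfolding OK_simps xy D unfolding x y D \<sigma> \<tau> by (simp add: algebra_simps)
    qed
  qed (auto simp: D_def)
  moreover have "D s = 1" using D[of 0 1] by simp
  ultimately show ?thesis by (rule that)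
qed

section \<open>Non-triviality of the outer derivations\<close>

text \<open>The criterion with both coordinates 0; it serves to place a derivation in its own
  coset.\<close>

lemma zero_map_inner: "zero_map OK \<in> inner_twisted_derivations \<Z> OK \<sigma> \<tau>"
proof -
  have "zero_map OK \<in> twisted_derivations \<Z> OK \<sigma> \<tau>"
    unfolding twisted_derivations_def zero_map_def by (auto intro: OK_add OK_mult)
  thus ?thesis by (subst inner_iff[of _ 0 0]) (auto simp: zero_map_def)
qed

lemma Out_nontrivial: "carrier (Out \<Z> OK \<sigma> \<tau>) \<noteq> {\<zero>\<^bsub>Out \<Z> OK \<sigma> \<tau>\<^esub>}"
proof
  define M where "M = derivation_module \<Z> OK \<sigma> \<tau>"
  define N where "N = inner_twisted_derivations \<Z> OK \<sigma> \<tau>"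
  assume "carrier (Out \<Z> OK \<sigma> \<tau>) = {\<zero>\<^bsub>Out \<Z> OK \<sigma> \<tau>\<^esub>}"
  hence trivial: "a_rcosets\<^bsub>M\<^esub> N = {N}" by (simp add: Out_def quotient_module_def M_def N_def)
  obtain D where D: "D \<in> twisted_derivations \<Z> OK \<sigma> \<tau>" "D s = 1" by (rule ex_derivation)
  have "D \<in> carrier M" using D(1) by (simp add: M_def derivation_module_def)
  \<comment> \<open>With a single coset, the coset of \<open>D\<close> is \<open>N\<close>; it
    contains \<open>D\<close> as zero plus \<open>D\<close>, so \<open>D\<close> would be
    inner.\<close>
  hence "N +>\<^bsub>M\<^esub> D = N" using trivial by (auto simp: A_RCOSETS_def')
  moreover have "zero_map OK \<oplus>\<^bsub>M\<^esub> D \<in> N +>\<^bsub>M\<^esub> D"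
    using zero_map_inner by (auto simp: a_r_coset_def' N_def)
  moreover have "zero_map OK \<oplus>\<^bsub>M\<^esub> D = D"
    using D(1) by (auto simp: M_def derivation_module_def zero_map_def twisted_derivations_def
        PiE_def extensional_def fun_eq_iff)
  ultimately have "D \<in> N" by simp
  \<comment> \<open>The value 1 at \<open>s\<close> has coordinates 1 and 0, and the even number
    \<open>2d\<close> cannot divide 1.\<close>
  hence "2 * d dvd 1" using inner_iff[OF D(1), of 1 0] D(2) by (simp add: N_def)
  thus False using dvd_mult_left[of 2 d 1] by simp
qed

end

theorem theorem3p4:
  fixes d :: int and \<sigma> \<tau> :: "complex \<Rightarrow> complex"
  assumes "squarefree d"
    and "\<not> [d = 1] (mod 4)"
    and "\<sigma> \<in> ring_endomorphisms (ring_of_integers d)"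
    and "\<tau> \<in> ring_endomorphisms (ring_of_integers d)"
    and "\<sigma> \<noteq> zero_map (ring_of_integers d)"
    and "\<tau> \<noteq> zero_map (ring_of_integers d)"
    and "\<sigma> \<noteq> \<tau>"
  shows "(\<forall>D \<in> twisted_derivations \<Z> (ring_of_integers d) \<sigma> \<tau>. \<forall>c\<^sub>0 c\<^sub>1 :: int.
            D (sqrt_int d) = of_int c\<^sub>0 + of_int c\<^sub>1 * sqrt_int d \<longrightarrow>
              (D \<in> inner_twisted_derivations \<Z> (ring_of_integers d) \<sigma> \<tau>
                 \<longleftrightarrow> 2 * d dvd c\<^sub>0 \<and> even c\<^sub>1) \<and>
              (2 * d dvd c\<^sub>0 \<and> 2 * d dvd c\<^sub>1 \<longrightarrow>
                 D \<in> inner_twisted_derivations \<Z> (ring_of_integers d) \<sigma> \<tau>)) \<and>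
         carrier (Out \<Z> (ring_of_integers d) \<sigma> \<tau>) \<noteq> {\<zero>\<^bsub>Out \<Z> (ring_of_integers d) \<sigma> \<tau>\<^esub>}"
proof -
  interpret quadratic_order d by unfold_locales (fact assms)+
  obtain e :: int where "e = 1 \<or> e = -1"
    "\<And>a b. \<sigma> (of_int a + of_int b * s) = of_int a + of_int (e * b) * s"
    "\<And>a b. \<tau> (of_int a + of_int b * s) = of_int a - of_int (e * b) * s"
    by (rule distinct_endomorphisms[OF assms(3-7)]) blast
  then interpret twisted_quadratic_order d \<sigma> \<tau> e by unfold_locales
  show ?thesis
    \<comment> \<open>Claim (i) follows from the criterion because a multiple of \<open>2d\<close>
      is even.\<close>
    using inner_iff Out_nontrivial dvd_mult_left[of 2 d] by blast
qed

end
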